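(* Let $X_1,X_2\subset\mathbb Z^m$ be digital images with adjacency $\kappa$ and $Y_1,Y_2\subset\mathbb Z^n$ digital images with adjacency $\lambda$. Suppose $X=X_1\wedge X_2$ is a wedge with wedge point $x_0$ and $Y=Y_1\wedge Y_2$ is a wedge with wedge point $y_0$. If $(X_1,x_0)\simeq^{\mathbb R}_{\kappa,\lambda}(Y_1,y_0)$ and $(X_2,x_0)\simeq^{\mathbb R}_{\kappa,\lambda}(Y_2,y_0)$, then $(X,x_0)\simeq^{\mathbb R}_{\kappa,\lambda}(Y,y_0)$.
   Context: A digital image $(X,\kappa)$ is a set $X\subset\mathbb Z^n$ (for some $n\ge 1$) with an adjacency relation $\kappa$ (a symmetric, irreflexive relation). A subset is $\kappa$-connected if any two distinct points of it are joined by a finite sequence of points of the subset whose consecutive members are $\kappa$-adjacent. A function $f:(X,\kappa)\to(Y,\lambda)$ is $(\kappa,\lambda)$-continuous if it maps $\kappa$-connected sets to $\lambda$-connected sets; equivalently, $\kappa$-adjacent points are mapped to equal or $\lambda$-adjacent points. Real path: $f:[0,1]\to (Y,\lambda)$ (with $[0,1]\subset\mathbb R$) is a real $\lambda$-path if (i) there is $\epsilon_0>0$ such that $f$ is constant on $(0,\epsilon_0)$ with value equal or $\lambda$-adjacent to $f(0)$; (ii) there is $\epsilon_1>0$ such that $f$ is constant on $(1-\epsilon_1,1)$ with value equal or $\lambda$-adjacent to $f(1)$; (iii) for each $t\in(0,1)$ there is $\epsilon_t>0$ such that $f$ is constant on each of $(t-\epsilon_t,t)$ and $(t,t+\epsilon_t)$,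 these two constant values are equal or $\lambda$-adjacent, and at least one of them equals $f(t)$. Real homotopy: for continuous $f,g:(X,\kappa)\to(Y,\lambda)$, a real homotopy from $f$ to $g$ is $F:X\times[0,1]\to Y$ with $F(x,0)=f(x)$, $F(x,1)=g(x)$ for all $x$, such that $t\mapsto F(x,t)$ is a real $\lambda$-path in $Y$ for each $x\in X$, and $x\mapsto F(x,t)$ is $(\kappa,\lambda)$-continuous for each $t\in[0,1]$. Then $f\simeq^{\mathbb R}g$. It is pointed with respect to $x_0\in X$, $y_0\in Y$ if $F(x_0,t)=y_0$ for all $t\in[0,1]$. $(X,x_0)\simeq^{\mathbb R}_{\kappa,\lambda}(Y,y_0)$ (same pointed real homotopy type) means there are continuous $f:X\to Y$, $g:Y\to X$ with $f(x_0)=y_0$, $g(y_0)=x_0$, a real homotopy from $g\circ f$ to $1_X$ that is constantly $x_0$ at $x_0$, and a real homotopy from $f\circ g$ to $1_Y$ that is constantly $y_0$ at $y_0$. Wedge: if $X_1,X_2\subset\mathbb Z^m$ carry the same adjacency $\kappa$, $X_1\cap X_2=\{x_0\}$, and no point of $X_1\setminus\{x_0\}$ is $\kappa$-adjacent to a point of $X_2\setminus\{x_0\}$, then $X=X_1\cup X_2$ with adjacency $\kappa$ is the wedge $X_1\wedge X_2$, with wedge point $x_0$. *)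

theory Defs
  imports "HOL-Analysis.Finite_Cartesian_Product"
begin

(* Adjacencies are relations on the ambient lattice int ^ 'n; only their restriction to the
   image in question matters.  Likewise maps between images are total functions whose values
   outside the domain are irrelevant. *)

type_synonym 'n adjacency = "int ^ 'n \<Rightarrow> int ^ 'n \<Rightarrow> bool"

definition digital_image :: "(int ^ 'n) set \<Rightarrow> 'n::finite adjacency \<Rightarrow> bool" where
  "digital_image X \<kappa> \<longleftrightarrow> irreflp_on X \<kappa> \<and> symp_on X \<kappa>"

definition adj_or_eq :: "'n::finite adjacency \<Rightarrow> int ^ 'n \<Rightarrow> int ^ 'n \<Rightarrow> bool" where
  "adj_or_eq \<kappa> x y \<longleftrightarrow> x = y \<or> \<kappa> x y"

definition dig_connected :: "'n::finite adjacency \<Rightarrow> (int ^ 'n) set \<Rightarrow> bool" where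
  "dig_connected \<kappa> S \<longleftrightarrow>
     (\<forall>x\<in>S. \<forall>y\<in>S. x \<noteq> y \<longrightarrow>
        (\<exists>p. p \<noteq> [] \<and> set p \<subseteq> S \<and> hd p = x \<and> last p = y \<and> successively \<kappa> p))"

definition dig_continuous ::
  "(int ^ 'm) set \<Rightarrow> 'm::finite adjacency \<Rightarrow> (int ^ 'n) set \<Rightarrow> 'n::finite adjacency
     \<Rightarrow> (int ^ 'm \<Rightarrow> int ^ 'n) \<Rightarrow> bool" where
  "dig_continuous X \<kappa> Y \<mu> f \<longleftrightarrow>
     f \<in> X \<rightarrow> Y \<and> (\<forall>A\<subseteq>X. dig_connected \<kappa> A \<longrightarrow> dig_connected \<mu> (f ` A))"

(* The bounds that keep the intervals inside [0,1] are omitted: each condition is inherited by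
   smaller positive epsilons, so values of f outside [0,1] play no role. *)
definition real_dig_path ::
  "(int ^ 'n) set \<Rightarrow> 'n::finite adjacency \<Rightarrow> (real \<Rightarrow> int ^ 'n) \<Rightarrow> bool" where
  "real_dig_path Y \<mu> f \<longleftrightarrow>
     f \<in> {0..1} \<rightarrow> Y \<and>
     (\<exists>\<epsilon>>0. \<exists>c. (\<forall>s\<in>{0<..<\<epsilon>}. f s = c) \<and> adj_or_eq \<mu> (f 0) c) \<and>
     (\<exists>\<epsilon>>0. \<exists>c. (\<forall>s\<in>{1-\<epsilon><..<1}. f s = c) \<and> adj_or_eq \<mu> (f 1) c) \<and>
     (\<forall>t\<in>{0<..<1}. \<exists>\<epsilon>>0. \<exists>a b.
        (\<forall>s\<in>{t-\<epsilon><..<t}. f s = a) \<and> (\<forall>s\<in>{t<..<t+\<epsilon>}. f s = b) \<and>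
        adj_or_eq \<mu> a b \<and> (f t = a \<or> f t = b))"

(* Continuity of f and g is the last clause at t = 0 and t = 1. *)
definition real_homotopy ::
  "(int ^ 'm) set \<Rightarrow> 'm::finite adjacency \<Rightarrow> (int ^ 'n) set \<Rightarrow> 'n::finite adjacency
     \<Rightarrow> (int ^ 'm \<Rightarrow> int ^ 'n) \<Rightarrow> (int ^ 'm \<Rightarrow> int ^ 'n)
     \<Rightarrow> (int ^ 'm \<Rightarrow> real \<Rightarrow> int ^ 'n) \<Rightarrow> bool" where
  "real_homotopy X \<kappa> Y \<mu> f g F \<longleftrightarrow>
     (\<forall>x\<in>X. F x 0 = f x \<and> F x 1 = g x) \<and>
     (\<forall>x\<in>X. real_dig_path Y \<mu> (\<lambda>t. F x t)) \<and>
     (\<forall>t\<in>{0..1}. dig_continuous X \<kappa> Y \<mu> (\<lambda>x. F x t))"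

definition pointed_real_homotopic ::
  "(int ^ 'm) set \<Rightarrow> 'm::finite adjacency \<Rightarrow> int ^ 'm
     \<Rightarrow> (int ^ 'n) set \<Rightarrow> 'n::finite adjacency \<Rightarrow> int ^ 'n
     \<Rightarrow> (int ^ 'm \<Rightarrow> int ^ 'n) \<Rightarrow> (int ^ 'm \<Rightarrow> int ^ 'n) \<Rightarrow> bool" where
  "pointed_real_homotopic X \<kappa> x\<^sub>0 Y \<mu> y\<^sub>0 f g \<longleftrightarrow>
     (\<exists>F. real_homotopy X \<kappa> Y \<mu> f g F \<and> (\<forall>t\<in>{0..1}. F x\<^sub>0 t = y\<^sub>0))"

definition same_pointed_real_homotopy_type ::
  "(int ^ 'm) set \<Rightarrow> 'm::finite adjacency \<Rightarrow> int ^ 'm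
     \<Rightarrow> (int ^ 'n) set \<Rightarrow> 'n::finite adjacency \<Rightarrow> int ^ 'n \<Rightarrow> bool" where
  "same_pointed_real_homotopy_type X \<kappa> x\<^sub>0 Y \<mu> y\<^sub>0 \<longleftrightarrow>
     x\<^sub>0 \<in> X \<and> y\<^sub>0 \<in> Y \<and>
     (\<exists>f g. dig_continuous X \<kappa> Y \<mu> f \<and> dig_continuous Y \<mu> X \<kappa> g \<and>
        f x\<^sub>0 = y\<^sub>0 \<and> g y\<^sub>0 = x\<^sub>0 \<and>
        pointed_real_homotopic X \<kappa> x\<^sub>0 X \<kappa> x\<^sub>0 (g \<circ> f) id \<and>
        pointed_real_homotopic Y \<mu> y\<^sub>0 Y \<mu> y\<^sub>0 (f \<circ> g) id)"

definition is_wedge ::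
  "(int ^ 'n) set \<Rightarrow> 'n::finite adjacency \<Rightarrow> (int ^ 'n) set \<Rightarrow> (int ^ 'n) set
     \<Rightarrow> int ^ 'n \<Rightarrow> bool" where
  "is_wedge X \<kappa> X\<^sub>1 X\<^sub>2 x\<^sub>0 \<longleftrightarrow>
     digital_image X \<kappa> \<and> X = X\<^sub>1 \<union> X\<^sub>2 \<and> X\<^sub>1 \<inter> X\<^sub>2 = {x\<^sub>0} \<and>
     (\<forall>x\<in>X\<^sub>1 - {x\<^sub>0}. \<forall>y\<in>X\<^sub>2 - {x\<^sub>0}. \<not> \<kappa> x y)"

end

(* Homotopy equivalences of the two halves agree at the wedge point, so maps and homotopies can be
   glued there.  The glued functions stay continuous because continuity is preservation of adjacency
   up to equality, and every adjacent pair of points of a wedge lies within one of the halves. *)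
theory Submission
  imports Defs
begin

text \<open>A list of successively adjacent points is unrolled into steps of the relation restricted
  to \<open>S\<close>, and a chain of such steps is collected into a list. The closure form allows
  rule induction on chains, and its reflexivity absorbs the case of equal endpoints.\<close>

lemma dig_connected_iff_rtranclp:
  "dig_connected \<kappa> S \<longleftrightarrow>
     (\<forall>x\<in>S. \<forall>y\<in>S. (\<lambda>a b. a \<in> S \<and> b \<in> S \<and> \<kappa> a b)\<^sup>*\<^sup>* x y)"
proof -
  let ?R = "\<lambda>a b. a \<in> S \<and> b \<in> S \<and> \<kappa> a b"
  have path_imp: "?R\<^sup>*\<^sup>* (hd p) (last p)"
    if "p \<noteq> []" "set p \<subseteq> S" "successively \<kappa> p" for p
    using that
  proof (induction p)
    case (Cons a p)
    show ?case
    proof (cases p)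
      case (Cons b q)
      then have "?R a b" and "?R\<^sup>*\<^sup>* b (last p)"
        using Cons.IH Cons.prems by auto
      then have "?R\<^sup>*\<^sup>* a (last p)"
        by (rule converse_rtranclp_into_rtranclp)
      then show ?thesis
        using Cons by simp
    qed simp
  qed simp
  \<comment> \<open>The premise \<open>y \<in> S\<close> serves the chain of length zero: the
    closure relates every point to itself, even outside \<open>S\<close>, while the witness
    \<open>[y]\<close> must stay inside \<open>S\<close>.\<close>
  have imp_path: "\<exists>p. p \<noteq> [] \<and> set p \<subseteq> S \<and> hd p = x \<and> last p = y \<and> successively \<kappa> p"
    if "?R\<^sup>*\<^sup>* x y" "y \<in> S" for x y
    using that
  proof (induction rule: converse_rtranclp_induct)
    case base
    then show ?case
      by (intro exI[of _ "[y]"]) simp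
  next
    case (step x z)
    then obtain p where "p \<noteq> []" "set p \<subseteq> S" "hd p = z" "last p = y" "successively \<kappa> p"
      by blast
    with step.hyps(1) show ?case
      by (intro exI[of _ "x # p"]) (auto simp: successively_Cons)
  qed
  show ?thesis
    unfolding dig_connected_def
  proof (intro iffI ballI impI)
    fix x y
    assume "\<forall>x\<in>S. \<forall>y\<in>S. x \<noteq> y \<longrightarrow>
        (\<exists>p. p \<noteq> [] \<and> set p \<subseteq> S \<and> hd p = x \<and> last p = y \<and> successively \<kappa> p)"
      and "x \<in> S" "y \<in> S"
    then show "?R\<^sup>*\<^sup>* x y"
      using path_imp by (cases "x = y") (simp, blast)
  qed (use imp_path in blast)
qed

text \<open>Forwards, an edge is itself a connected set, so its image is a connected set of at most
  two points. Backwards, a chain is mapped step by step. This reduces continuity to a condition on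
  single edges, which is what gluing can handle.\<close>

lemma dig_continuous_iff_adj:
  assumes "symp_on X \<kappa>"
  shows "dig_continuous X \<kappa> Y \<mu> f \<longleftrightarrow>
    f \<in> X \<rightarrow> Y \<and> (\<forall>x\<in>X. \<forall>y\<in>X. \<kappa> x y \<longrightarrow> adj_or_eq \<mu> (f x) (f y))"
proof (intro iffI conjI ballI impI)
  assume cont: "dig_continuous X \<kappa> Y \<mu> f"
  then show "f \<in> X \<rightarrow> Y"
    by (simp add: dig_continuous_def)
  fix x y
  assume xy: "x \<in> X" "y \<in> X" "\<kappa> x y"
  \<comment> \<open>Connectedness of the pair asks for a chain from each point to the other, so both
    orientations of the edge are required.\<close>
  with assms have "\<kappa> y x"
    by (auto dest: symp_onD)
  with xy have "dig_connected \<kappa> {x, y}"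
    unfolding dig_connected_iff_rtranclp by auto
  then have conn: "dig_connected \<mu> {f x, f y}"
    using cont xy unfolding dig_continuous_def by (auto dest!: spec[of _ "{x, y}"])
  \<comment> \<open>A chain starting at \<open>f x\<close> inside the pair can reach
    \<open>f y \<noteq> f x\<close> only by a step that leaves \<open>f x\<close> itself, so that
    step is the desired adjacency.\<close>
  have "adj_or_eq \<mu> (f x) z"
    if "(\<lambda>a b. a \<in> {f x, f y} \<and> b \<in> {f x, f y} \<and> \<mu> a b)\<^sup>*\<^sup>* (f x) z" for z
    using that by (induction rule: rtranclp_induct) (auto simp: adj_or_eq_def)
  then show "adj_or_eq \<mu> (f x) (f y)"
    using conn unfolding dig_connected_iff_rtranclp by blast
next
  assume adj: "f \<in> X \<rightarrow> Y \<and> (\<forall>x\<in>X. \<forall>y\<in>X. \<kappa> x y \<longrightarrow> adj_or_eq \<mu> (f x) (f y))"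
  have "dig_connected \<mu> (f ` A)" if "A \<subseteq> X" "dig_connected \<kappa> A" for A
  proof -
    have "(\<lambda>a b. a \<in> f ` A \<and> b \<in> f ` A \<and> \<mu> a b)\<^sup>*\<^sup>* (f x) (f y)"
      if "(\<lambda>a b. a \<in> A \<and> b \<in> A \<and> \<kappa> a b)\<^sup>*\<^sup>* x y" for x y
      using that
    proof (induction rule: rtranclp_induct)
      case (step y z)
      \<comment> \<open>An edge collapsed by \<open>f\<close> adds nothing to the image chain; any
        other edge becomes one more step of it.\<close>
      then have "f y = f z \<or> \<mu> (f y) (f z)"
        using adj \<open>A \<subseteq> X\<close> by (auto simp: adj_or_eq_def)
      with step show ?case
        by (auto intro: rtranclp.rtrancl_into_rtrancl)
    qed simp
    with \<open>dig_connected \<kappa> A\<close> show ?thesis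
      unfolding dig_connected_iff_rtranclp by blast
  qed
  with adj show "dig_continuous X \<kappa> Y \<mu> f"
    by (simp add: dig_continuous_def)
qed

lemma real_dig_path_mono:
  "real_dig_path Y \<mu> p \<Longrightarrow> Y \<subseteq> Z \<Longrightarrow> real_dig_path Z \<mu> p"
  unfolding real_dig_path_def by blast

text \<open>The wedge condition excludes edges from the first half to the second away from
  \<open>x\<^sub>0\<close>; symmetry of \<kappa> excludes those in the opposite order. An edge at
  \<open>x\<^sub>0\<close> lies in the half of its other endpoint, as \<open>x\<^sub>0\<close>
  belongs to both.\<close>

lemma is_wedge_adj_cases:
  assumes "is_wedge X \<kappa> X\<^sub>1 X\<^sub>2 x\<^sub>0" "x \<in> X" "y \<in> X" "\<kappa> x y"
  obtains "x \<in> X\<^sub>1" "y \<in> X\<^sub>1" | "x \<in> X\<^sub>2" "y \<in> X\<^sub>2"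
proof -
  have "\<kappa> y x"
    using assms by (auto simp: is_wedge_def digital_image_def dest: symp_onD)
  with assms have "x \<in> X\<^sub>1 \<and> y \<in> X\<^sub>1 \<or> x \<in> X\<^sub>2 \<and> y \<in> X\<^sub>2"
    unfolding is_wedge_def by blast
  with that show thesis
    by blast
qed

text \<open>The map \<open>f\<close> is described by its agreement with the two pieces rather than
  by a formula, so that the lemma covers both the glued equivalences and each time slice of a glued
  homotopy.\<close>

lemma dig_continuous_wedge:
  assumes wedge: "is_wedge X \<kappa> X\<^sub>1 X\<^sub>2 x\<^sub>0"
    and cont: "dig_continuous X\<^sub>1 \<kappa> Y\<^sub>1 \<mu> f\<^sub>1" "dig_continuous X\<^sub>2 \<kappa> Y\<^sub>2 \<mu> f\<^sub>2"
    and sub: "Y\<^sub>1 \<subseteq> Y" "Y\<^sub>2 \<subseteq> Y"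
    and eq: "\<And>x. x \<in> X\<^sub>1 \<Longrightarrow> f x = f\<^sub>1 x" "\<And>x. x \<in> X\<^sub>2 \<Longrightarrow> f x = f\<^sub>2 x"
  shows "dig_continuous X \<kappa> Y \<mu> f"
proof -
  have X: "X = X\<^sub>1 \<union> X\<^sub>2" and sym: "symp_on X \<kappa>"
    using wedge by (auto simp: is_wedge_def digital_image_def)
  then have "symp_on X\<^sub>1 \<kappa>" "symp_on X\<^sub>2 \<kappa>"
    by (auto intro: symp_on_subset)
  then have map: "f\<^sub>1 \<in> X\<^sub>1 \<rightarrow> Y\<^sub>1" "f\<^sub>2 \<in> X\<^sub>2 \<rightarrow> Y\<^sub>2"
    and adj\<^sub>1: "\<And>x y. x \<in> X\<^sub>1 \<Longrightarrow> y \<in> X\<^sub>1 \<Longrightarrow> \<kappa> x y \<Longrightarrow> adj_or_eq \<mu> (f\<^sub>1 x) (f\<^sub>1 y)"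
    and adj\<^sub>2: "\<And>x y. x \<in> X\<^sub>2 \<Longrightarrow> y \<in> X\<^sub>2 \<Longrightarrow> \<kappa> x y \<Longrightarrow> adj_or_eq \<mu> (f\<^sub>2 x) (f\<^sub>2 y)"
    using cont by (simp_all add: dig_continuous_iff_adj)
  have "f \<in> X \<rightarrow> Y"
    using map sub eq X by (auto simp: Pi_iff)
  moreover have "adj_or_eq \<mu> (f x) (f y)" if "x \<in> X" "y \<in> X" "\<kappa> x y" for x y
    using wedge that by (cases rule: is_wedge_adj_cases) (simp_all add: eq adj\<^sub>1 adj\<^sub>2 \<open>\<kappa> x y\<close>)
  ultimately show ?thesis
    using sym by (simp add: dig_continuous_iff_adj)
qed

text \<open>Both homotopies rest at \<open>y\<^sub>0\<close> over the wedge point, so they can be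
  glued in space with time left untouched. The ends \<open>f\<close> and \<open>g\<close> are again
  given by agreement on the halves, which suits composites and the identity.\<close>

lemma pointed_real_homotopic_wedge:
  assumes wedge: "is_wedge X \<kappa> X\<^sub>1 X\<^sub>2 x\<^sub>0"
    and hom: "pointed_real_homotopic X\<^sub>1 \<kappa> x\<^sub>0 Y\<^sub>1 \<mu> y\<^sub>0 f\<^sub>1 g\<^sub>1"
      "pointed_real_homotopic X\<^sub>2 \<kappa> x\<^sub>0 Y\<^sub>2 \<mu> y\<^sub>0 f\<^sub>2 g\<^sub>2"
    and sub: "Y\<^sub>1 \<subseteq> Y" "Y\<^sub>2 \<subseteq> Y"
    and f: "\<And>x. x \<in> X\<^sub>1 \<Longrightarrow> f x = f\<^sub>1 x" "\<And>x. x \<in> X\<^sub>2 \<Longrightarrow> f x = f\<^sub>2 x"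
    and g: "\<And>x. x \<in> X\<^sub>1 \<Longrightarrow> g x = g\<^sub>1 x" "\<And>x. x \<in> X\<^sub>2 \<Longrightarrow> g x = g\<^sub>2 x"
  shows "pointed_real_homotopic X \<kappa> x\<^sub>0 Y \<mu> y\<^sub>0 f g"
proof -
  obtain F\<^sub>1 F\<^sub>2
    where F\<^sub>1: "real_homotopy X\<^sub>1 \<kappa> Y\<^sub>1 \<mu> f\<^sub>1 g\<^sub>1 F\<^sub>1" and F\<^sub>1_pt: "\<And>t. t \<in> {0..1} \<Longrightarrow> F\<^sub>1 x\<^sub>0 t = y\<^sub>0"
      and F\<^sub>2: "real_homotopy X\<^sub>2 \<kappa> Y\<^sub>2 \<mu> f\<^sub>2 g\<^sub>2 F\<^sub>2" and F\<^sub>2_pt: "\<And>t. t \<in> {0..1} \<Longrightarrow> F\<^sub>2 x\<^sub>0 t = y\<^sub>0"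
    using hom unfolding pointed_real_homotopic_def by blast
  have X: "X = X\<^sub>1 \<union> X\<^sub>2" and int: "X\<^sub>1 \<inter> X\<^sub>2 = {x\<^sub>0}"
    using wedge by (auto simp: is_wedge_def)
  define F where "F x = (if x \<in> X\<^sub>1 then F\<^sub>1 x else F\<^sub>2 x)" for x
  have F_X\<^sub>1: "F x t = F\<^sub>1 x t" if "x \<in> X\<^sub>1" for x t
    using that by (simp add: F_def)
  \<comment> \<open>The case distinction in \<open>F\<close> favours the first half, so on the
    second half only \<open>x\<^sub>0\<close> needs an argument. There the two homotopies are known
    to coincide only for times in the unit interval, hence the restriction on
    \<open>t\<close>.\<close>
  have F_X\<^sub>2: "F x t = F\<^sub>2 x t" if "x \<in> X\<^sub>2" "t \<in> {0..1}" for x t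
  proof (cases "x \<in> X\<^sub>1")
    case True
    with int that have "x = x\<^sub>0"
      by blast
    with True that show ?thesis
      by (simp add: F_def F\<^sub>1_pt F\<^sub>2_pt)
  qed (simp add: F_def)
  have "F x 0 = f x \<and> F x 1 = g x" if "x \<in> X" for x
    using that X F\<^sub>1 F\<^sub>2 f g by (auto simp: real_homotopy_def F_X\<^sub>1 F_X\<^sub>2)
  \<comment> \<open>Each track \<open>F x\<close> is, as a whole function of time, a track of one of
    the two homotopies. Unfolding \<open>F_def\<close> gives this equality at all real times, so
    only the target has to be enlarged to \<open>Y\<close>.\<close>
  moreover have "real_dig_path Y \<mu> (F x)" if "x \<in> X" for x
    using that X F\<^sub>1 F\<^sub>2 sub by (auto simp: real_homotopy_def F_def intro: real_dig_path_mono)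
  moreover have "dig_continuous X \<kappa> Y \<mu> (\<lambda>x. F x t)" if t: "t \<in> {0..1}" for t
  proof (rule dig_continuous_wedge[OF wedge _ _ sub])
    show "dig_continuous X\<^sub>1 \<kappa> Y\<^sub>1 \<mu> (\<lambda>x. F\<^sub>1 x t)" "dig_continuous X\<^sub>2 \<kappa> Y\<^sub>2 \<mu> (\<lambda>x. F\<^sub>2 x t)"
      using F\<^sub>1 F\<^sub>2 t by (simp_all add: real_homotopy_def)
  qed (simp_all only: F_X\<^sub>1 F_X\<^sub>2 t)
  moreover have "F x\<^sub>0 t = y\<^sub>0" if "t \<in> {0..1}" for t
    using int that F_X\<^sub>1 F\<^sub>1_pt by blast
  ultimately show ?thesis
    unfolding pointed_real_homotopic_def real_homotopy_def by blast
qed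

theorem theorem8p3:
  fixes X X\<^sub>1 X\<^sub>2 :: "(int ^ 'm::finite) set" and \<kappa> :: "'m adjacency" and x\<^sub>0 :: "int ^ 'm"
    and Y Y\<^sub>1 Y\<^sub>2 :: "(int ^ 'n::finite) set" and \<mu> :: "'n adjacency" and y\<^sub>0 :: "int ^ 'n"
  assumes "digital_image X\<^sub>1 \<kappa>" and "digital_image X\<^sub>2 \<kappa>"
    and "digital_image Y\<^sub>1 \<mu>" and "digital_image Y\<^sub>2 \<mu>"
    and "is_wedge X \<kappa> X\<^sub>1 X\<^sub>2 x\<^sub>0"
    and "is_wedge Y \<mu> Y\<^sub>1 Y\<^sub>2 y\<^sub>0"
    and "same_pointed_real_homotopy_type X\<^sub>1 \<kappa> x\<^sub>0 Y\<^sub>1 \<mu> y\<^sub>0"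
    and "same_pointed_real_homotopy_type X\<^sub>2 \<kappa> x\<^sub>0 Y\<^sub>2 \<mu> y\<^sub>0"
  shows "same_pointed_real_homotopy_type X \<kappa> x\<^sub>0 Y \<mu> y\<^sub>0"
proof -
  obtain f\<^sub>1 g\<^sub>1
    where f\<^sub>1: "dig_continuous X\<^sub>1 \<kappa> Y\<^sub>1 \<mu> f\<^sub>1" "f\<^sub>1 x\<^sub>0 = y\<^sub>0"
      and g\<^sub>1: "dig_continuous Y\<^sub>1 \<mu> X\<^sub>1 \<kappa> g\<^sub>1" "g\<^sub>1 y\<^sub>0 = x\<^sub>0"
      and gf\<^sub>1: "pointed_real_homotopic X\<^sub>1 \<kappa> x\<^sub>0 X\<^sub>1 \<kappa> x\<^sub>0 (g\<^sub>1 \<circ> f\<^sub>1) id"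
      and fg\<^sub>1: "pointed_real_homotopic Y\<^sub>1 \<mu> y\<^sub>0 Y\<^sub>1 \<mu> y\<^sub>0 (f\<^sub>1 \<circ> g\<^sub>1) id"
    using assms(7) unfolding same_pointed_real_homotopy_type_def by blast
  obtain f\<^sub>2 g\<^sub>2
    where f\<^sub>2: "dig_continuous X\<^sub>2 \<kappa> Y\<^sub>2 \<mu> f\<^sub>2" "f\<^sub>2 x\<^sub>0 = y\<^sub>0"
      and g\<^sub>2: "dig_continuous Y\<^sub>2 \<mu> X\<^sub>2 \<kappa> g\<^sub>2" "g\<^sub>2 y\<^sub>0 = x\<^sub>0"
      and gf\<^sub>2: "pointed_real_homotopic X\<^sub>2 \<kappa> x\<^sub>0 X\<^sub>2 \<kappa> x\<^sub>0 (g\<^sub>2 \<circ> f\<^sub>2) id"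
      and fg\<^sub>2: "pointed_real_homotopic Y\<^sub>2 \<mu> y\<^sub>0 Y\<^sub>2 \<mu> y\<^sub>0 (f\<^sub>2 \<circ> g\<^sub>2) id"
    using assms(8) unfolding same_pointed_real_homotopy_type_def by blast
  note wedge_X = assms(5) and wedge_Y = assms(6)
  have X: "X\<^sub>1 \<subseteq> X" "X\<^sub>2 \<subseteq> X" "X\<^sub>1 \<inter> X\<^sub>2 = {x\<^sub>0}"
    using wedge_X by (auto simp: is_wedge_def)
  have Y: "Y\<^sub>1 \<subseteq> Y" "Y\<^sub>2 \<subseteq> Y" "Y\<^sub>1 \<inter> Y\<^sub>2 = {y\<^sub>0}"
    using wedge_Y by (auto simp: is_wedge_def)
  define f where "f x = (if x \<in> X\<^sub>1 then f\<^sub>1 x else f\<^sub>2 x)" for x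
  define g where "g y = (if y \<in> Y\<^sub>1 then g\<^sub>1 y else g\<^sub>2 y)" for y
  have f_eq: "f x = f\<^sub>1 x" if "x \<in> X\<^sub>1" for x
    using that by (simp add: f_def)
  \<comment> \<open>The halves overlap only in \<open>x\<^sub>0\<close>, where both pieces take the
    value \<open>y\<^sub>0\<close>.\<close>
  have f_eq': "f x = f\<^sub>2 x" if "x \<in> X\<^sub>2" for x
    using that X(3) f\<^sub>1(2) f\<^sub>2(2) by (cases "x = x\<^sub>0") (auto simp: f_def)
  have g_eq: "g y = g\<^sub>1 y" if "y \<in> Y\<^sub>1" for y
    using that by (simp add: g_def)
  have g_eq': "g y = g\<^sub>2 y" if "y \<in> Y\<^sub>2" for y
    using that Y(3) g\<^sub>1(2) g\<^sub>2(2) by (cases "y = y\<^sub>0") (auto simp: g_def)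
  have maps: "\<And>x. x \<in> X\<^sub>1 \<Longrightarrow> f\<^sub>1 x \<in> Y\<^sub>1" "\<And>x. x \<in> X\<^sub>2 \<Longrightarrow> f\<^sub>2 x \<in> Y\<^sub>2"
    "\<And>y. y \<in> Y\<^sub>1 \<Longrightarrow> g\<^sub>1 y \<in> X\<^sub>1" "\<And>y. y \<in> Y\<^sub>2 \<Longrightarrow> g\<^sub>2 y \<in> X\<^sub>2"
    using f\<^sub>1(1) f\<^sub>2(1) g\<^sub>1(1) g\<^sub>2(1) by (auto simp: dig_continuous_def)
  have pt: "x\<^sub>0 \<in> X\<^sub>1" "y\<^sub>0 \<in> Y\<^sub>1"
    using X(3) Y(3) by auto
  have "dig_continuous X \<kappa> Y \<mu> f"
    by (rule dig_continuous_wedge[OF wedge_X f\<^sub>1(1) f\<^sub>2(1) Y(1,2) f_eq f_eq'])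
  moreover have "dig_continuous Y \<mu> X \<kappa> g"
    by (rule dig_continuous_wedge[OF wedge_Y g\<^sub>1(1) g\<^sub>2(1) X(1,2) g_eq g_eq'])
  \<comment> \<open>Each \<open>f\<close> piece sends its half of \<open>X\<close> into the matching
    half of \<open>Y\<close>, where \<open>g\<close> is the matching piece. Hence
    \<open>g \<circ> f\<close> restricts to the composite of the pieces on each half; the other
    composite is treated in the same way.\<close>
  moreover have "pointed_real_homotopic X \<kappa> x\<^sub>0 X \<kappa> x\<^sub>0 (g \<circ> f) id"
    by (rule pointed_real_homotopic_wedge[OF wedge_X gf\<^sub>1 gf\<^sub>2 X(1,2)])
      (simp_all add: f_eq f_eq' g_eq g_eq' maps)
  moreover have "pointed_real_homotopic Y \<mu> y\<^sub>0 Y \<mu> y\<^sub>0 (f \<circ> g) id"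
    by (rule pointed_real_homotopic_wedge[OF wedge_Y fg\<^sub>1 fg\<^sub>2 Y(1,2)])
      (simp_all add: f_eq f_eq' g_eq g_eq' maps)
  moreover have "f x\<^sub>0 = y\<^sub>0" "g y\<^sub>0 = x\<^sub>0"
    by (simp_all only: pt f_eq g_eq f\<^sub>1(2) g\<^sub>1(2))
  moreover have "x\<^sub>0 \<in> X" "y\<^sub>0 \<in> Y"
    using pt X(1) Y(1) by auto
  ultimately show ?thesis
    unfolding same_pointed_real_homotopy_type_def
    by blast
qed

end
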